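(* Splitting is a minor-closed property: if a graph $G$ splits and $G_m$ is a minor of $G$, then $G_m$ splits.
   Context: Graphs are finite undirected multigraphs, possibly with loops and parallel edges. A minor of $G$ is a graph obtained from $G$ by a (possibly empty) sequence of edge deletions and edge contractions. Contracting an edge removes it and identifies its ends (parallel edges and loops created are kept). Dodgson polynomials: assign a variable $\alpha_e$ to each edge $e$ of $G$. Orient the edges arbitrarily, let $\xi_G$ be the $|E(G)|\times|V(G)|$ incidence matrix with $(\xi_G)_{e,v}=1$ if $v$ is the source of $e$, $-1$ if $v$ is the target of $e$, and $0$ otherwise (the row of a loop is zero), let $\widehat\xi_G$ be $\xi_G$ with one arbitrary column deleted, and let $A$ be the diagonal matrix with entries $\alpha_e$. Put $$M_G=\begin{pmatrix}A&\widehat\xi_G\\-\widehat\xi_G^{\,T}&0\end{pmatrix}.$$ For $I,J,K\subseteq E(G)$ with $|I|=|J|$, the Dodgson polynomial $\Psi^{I,J}_K$ is the determinant of the matrix obtained from $M_G$ by deleting the rows indexed by $I$, deleting the columns indexed by $J$, and setting $\alpha_e=0$ for all $e\in K$; it is well defined up to sign. A $5$-configuration is a set $S\subseteq E(G)$ with $|S|=5$. $D_S$ is the set of (thirty) Dodgson polynomials $\Psi^{I,J}_K$ with $I\cup J\cup K=S$, $K$ disjoint from $I\cup J$, and either $|I|=|J|=2$, $I\cap J=\emptyset$, $|K|=1$, or $|I|=|J|=3$, $|I\cap J|=1$, $K=\emptyset$. The $5$-configuration $S$ splits if at least one $D\in D_S$ is the zero polynomial; otherwise $S$ is non-splitting.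 A graph $G$ splits if every $5$-configuration $S\subseteq E(G)$ splits. *)

theory Defs
  imports "HOL-Library.Poly_Mapping" "Jordan_Normal_Form.Determinant"
begin

text \<open>The set \<open>ends G e\<close> consists of the two ends of \<open>e\<close>; it is a singleton iff \<open>e\<close> is a loop.
  Distinct edges may have the same ends. Values of \<open>ends G\<close> outside \<open>edges G\<close> are irrelevant.\<close>

record ('v, 'e) pre_multigraph =
  verts :: "'v set"
  edges :: "'e set"
  ends :: "'e \<Rightarrow> 'v set"

definition multigraph :: "('v, 'e) pre_multigraph \<Rightarrow> bool" where
  "multigraph G \<longleftrightarrow> finite (verts G) \<and> finite (edges G) \<and>
     (\<forall>e\<in>edges G. ends G e \<subseteq> verts G \<and> (card (ends G e) = 1 \<or> card (ends G e) = 2))"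

definition delete_edge :: "('v, 'e) pre_multigraph \<Rightarrow> 'e \<Rightarrow> ('v, 'e) pre_multigraph" where
  "delete_edge G e = G\<lparr>edges := edges G - {e}\<rparr>"

text \<open>\<open>contracts_to G e H\<close>: \<open>H\<close> arises from \<open>G\<close> by contracting \<open>e\<close>. The map \<open>\<phi>\<close> is the quotient map
  on vertices, which identifies exactly the ends of \<open>e\<close>; the names of the resulting vertices are
  arbitrary. If \<open>e\<close> is a loop, \<open>\<phi>\<close> is injective, so that contracting \<open>e\<close> amounts to deleting it.\<close>

definition contracts_to ::
    "('v, 'e) pre_multigraph \<Rightarrow> 'e \<Rightarrow> ('v, 'e) pre_multigraph \<Rightarrow> bool" where
  "contracts_to G e H \<longleftrightarrow> e \<in> edges G \<and> edges H = edges G - {e} \<and>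
     (\<exists>\<phi>. verts H = \<phi> ` verts G \<and>
          (\<forall>x\<in>verts G. \<forall>y\<in>verts G. \<phi> x = \<phi> y \<longleftrightarrow> x = y \<or> {x, y} = ends G e) \<and>
          (\<forall>f\<in>edges H. ends H f = \<phi> ` ends G f))"

inductive minor_of :: "('v, 'e) pre_multigraph \<Rightarrow> ('v, 'e) pre_multigraph \<Rightarrow> bool" where
  refl: "minor_of G G"
| delete: "minor_of H G \<Longrightarrow> e \<in> edges H \<Longrightarrow> minor_of (delete_edge H e) G"
| contract: "minor_of H G \<Longrightarrow> contracts_to H e H' \<Longrightarrow> minor_of H' G"

text \<open>Polynomials with integer coefficients in variables indexed by \<open>'e\<close>: finitely supported
  functions from monomials (finitely supported exponent functions) to coefficients, with the
  convolution product.\<close>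

type_synonym 'e poly_in = "('e \<Rightarrow>\<^sub>0 nat) \<Rightarrow>\<^sub>0 int"

definition edge_var :: "'e \<Rightarrow> 'e poly_in" where
  "edge_var e = Poly_Mapping.single (Poly_Mapping.single e 1) 1"

definition incidence :: "('e \<Rightarrow> 'v) \<Rightarrow> ('e \<Rightarrow> 'v) \<Rightarrow> 'e \<Rightarrow> 'v \<Rightarrow> 'e poly_in" where
  "incidence src tgt e v =
     (if src e = tgt e then 0 else if v = src e then 1 else if v = tgt e then - 1 else 0)"

text \<open>The matrix \<open>M\<^sub>G\<close> with rows and columns labelled by edges (\<open>Inl\<close>) and vertices (\<open>Inr\<close>),
  where \<open>a\<close> gives the diagonal entries of \<open>A\<close>. The omitted vertex column is left out by the choice
  of labels in \<open>dodgson_det\<close>.\<close>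

fun graph_matrix :: "('e \<Rightarrow> 'v) \<Rightarrow> ('e \<Rightarrow> 'v) \<Rightarrow> ('e \<Rightarrow> 'e poly_in) \<Rightarrow> 'e + 'v \<Rightarrow> 'e + 'v \<Rightarrow> 'e poly_in"
where
  "graph_matrix src tgt a (Inl e) (Inl f) = (if e = f then a e else 0)"
| "graph_matrix src tgt a (Inl e) (Inr v) = incidence src tgt e v"
| "graph_matrix src tgt a (Inr v) (Inl e) = - incidence src tgt e v"
| "graph_matrix src tgt a (Inr v) (Inr w) = 0"

text \<open>Here \<open>es\<close> lists the edges and \<open>vs\<close> lists all vertices but one.\<close>

definition dodgson_det ::
    "('e \<Rightarrow> 'v) \<times> ('e \<Rightarrow> 'v) \<times> 'e list \<times> 'v list \<Rightarrow> 'e set \<Rightarrow> 'e set \<Rightarrow> 'e set \<Rightarrow> 'e poly_in" where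
  "dodgson_det c I J K =
     (case c of (src, tgt, es, vs) \<Rightarrow>
       let rows = map Inl (filter (\<lambda>e. e \<notin> I) es) @ map Inr vs;
           cols = map Inl (filter (\<lambda>e. e \<notin> J) es) @ map Inr vs;
           a = (\<lambda>e. if e \<in> K then 0 else edge_var e)
       in det (mat (length rows) (length cols)
                 (\<lambda>(i, j). graph_matrix src tgt a (rows ! i) (cols ! j))))"

text \<open>The arbitrary choices in the definition of \<open>M\<^sub>G\<close>: an orientation, an order of the edges, and
  an order of the vertices other than one omitted vertex \<open>r\<close>.\<close>

definition admissible_choice ::
    "('v, 'e) pre_multigraph \<Rightarrow> ('e \<Rightarrow> 'v) \<times> ('e \<Rightarrow> 'v) \<times> 'e list \<times> 'v list \<Rightarrow> bool" where
  "admissible_choice G c \<longleftrightarrow>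
     (case c of (src, tgt, es, vs) \<Rightarrow>
       (\<forall>e\<in>edges G. ends G e = {src e, tgt e}) \<and>
       distinct es \<and> set es = edges G \<and>
       distinct vs \<and> (\<exists>r\<in>verts G. set vs = verts G - {r}))"

lemma admissible_choice_exists:
  assumes G: "multigraph G" and ne: "verts G \<noteq> {}"
  shows "\<exists>c. admissible_choice G c"
proof -
  have "\<exists>s t. ends G e = {s, t}" if "e \<in> edges G" for e
  proof -
    have "card (ends G e) = 1 \<or> card (ends G e) = 2"
      using G that by (auto simp: multigraph_def)
    then show ?thesis
      by (metis card_1_singletonE card_2_iff insert_absorb2)
  qed
  then obtain src tgt where "\<forall>e\<in>edges G. ends G e = {src e, tgt e}" by metis
  moreover obtain es where "distinct es" "set es = edges G"
    using G finite_distinct_list by (metis multigraph_def)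
  moreover obtain r where r: "r \<in> verts G" using ne by blast
  moreover obtain vs where "distinct vs" "set vs = verts G - {r}"
    using G finite_distinct_list[of "verts G - {r}"] by (auto simp: multigraph_def)
  ultimately have "admissible_choice G (src, tgt, es, vs)"
    unfolding admissible_choice_def by auto
  then show ?thesis ..
qed

text \<open>The Dodgson polynomial is well defined only up to sign; one representative is picked by fixing,
  once for each graph, arbitrary admissible choices. If \<open>G\<close> has no vertices there are none, but then
  \<open>G\<close> has no edges either and the value is never used below.\<close>

definition dodgson_poly ::
    "('v, 'e) pre_multigraph \<Rightarrow> 'e set \<Rightarrow> 'e set \<Rightarrow> 'e set \<Rightarrow> 'e poly_in" where
  "dodgson_poly G = dodgson_det (SOME c. admissible_choice G c)"

definition five_configuration :: "('v, 'e) pre_multigraph \<Rightarrow> 'e set \<Rightarrow> bool" where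
  "five_configuration G S \<longleftrightarrow> S \<subseteq> edges G \<and> card S = 5"

definition dodgson_polys :: "('v, 'e) pre_multigraph \<Rightarrow> 'e set \<Rightarrow> 'e poly_in set" where
  "dodgson_polys G S =
     {dodgson_poly G I J K | I J K.
        I \<union> J \<union> K = S \<and> K \<inter> (I \<union> J) = {} \<and>
        (card I = 2 \<and> card J = 2 \<and> I \<inter> J = {} \<and> card K = 1 \<or>
         card I = 3 \<and> card J = 3 \<and> card (I \<inter> J) = 1 \<and> K = {})}"

definition config_splits :: "('v, 'e) pre_multigraph \<Rightarrow> 'e set \<Rightarrow> bool" where
  "config_splits G S \<longleftrightarrow> (\<exists>D\<in>dodgson_polys G S. D = 0)"

definition splits :: "('v, 'e) pre_multigraph \<Rightarrow> bool" where
  "splits G \<longleftrightarrow> (\<forall>S. five_configuration G S \<longrightarrow> config_splits G S)"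

end

theory Submission
  imports Defs
begin

text \<open>Let \<open>e\<close> be an edge outside \<open>S\<close>. A Dodgson polynomial of \<open>G\<close> for \<open>S\<close> is linear in the variable
  of \<open>e\<close>. Its leading coefficient is the same Dodgson polynomial of the graph with \<open>e\<close> deleted, and
  its constant term is, up to sign, that of the graph with \<open>e\<close> contracted, unless \<open>e\<close> is a loop, in
  which case contraction is deletion. So if the polynomial vanishes for \<open>G\<close>, it vanishes for both
  one-step minors. Only the vanishing matters, and it does not depend on the orientation, the
  orders or the omitted vertex; for a contraction the omitted vertex is taken to be an end of
  \<open>e\<close>.\<close>

section \<open>Determinants of matrices whose rows and columns carry labels\<close>

text \<open>Labels replace indices, so deleting or moving rows and columns becomes an operation on
  lists. For lists of different lengths the value is the default 0 of \<open>det\<close> on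
  non-square matrices.\<close>

definition list_det :: "('a \<Rightarrow> 'b \<Rightarrow> 'c::comm_ring_1) \<Rightarrow> 'a list \<Rightarrow> 'b list \<Rightarrow> 'c" where
  "list_det F xs ys = det (mat (length xs) (length ys) (\<lambda>(i, j). F (xs ! i) (ys ! j)))"

lemma list_det_cong:
  assumes "\<And>x y. x \<in> set xs \<Longrightarrow> y \<in> set ys \<Longrightarrow> F x y = F' x y"
  shows "list_det F xs ys = list_det F' xs ys"
  unfolding list_det_def by (intro arg_cong[of _ _ det] eq_matI) (auto simp: assms)

lemma list_det_map:
  "list_det F (map f xs) (map g ys) = list_det (\<lambda>x y. F (f x) (g y)) xs ys"
  unfolding list_det_def by (intro arg_cong[of _ _ det] eq_matI) auto

text \<open>The bridge from statements on columns to statements on rows; for different lengths both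
  sides are the default 0.\<close>

lemma list_det_transpose: "list_det (\<lambda>y x. F x y) ys xs = list_det F xs ys"
proof (cases "length xs = length ys")
  case True
  let ?A = "mat (length xs) (length ys) (\<lambda>(i, j). F (xs ! i) (ys ! j))"
  have "det (transpose_mat ?A) = det ?A"
    by (rule det_transpose[of _ "length xs"]) (simp add: True)
  moreover have "transpose_mat ?A = mat (length ys) (length xs) (\<lambda>(i, j). F (xs ! j) (ys ! i))"
    by (rule eq_matI) auto
  ultimately show ?thesis by (simp add: list_det_def)
next
  case False
  then show ?thesis by (simp add: list_det_def det_def)
qed

text \<open>Permuting rows multiplies the determinant by the sign of the permutation. Recording only
  the vanishing allows this sign to be forgotten.\<close>

lemma list_det_permute_rows_eq_0:
  assumes "mset xs = mset xs'" and "list_det F xs' ys = 0"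
  shows "list_det F xs ys = 0"
proof (cases "length xs = length ys")
  case True
  have len: "length xs' = length ys" using mset_eq_length[OF assms(1)] True by simp
  obtain p where p: "p permutes {..<length xs'}" "permute_list p xs' = xs"
    using mset_eq_permutation[OF assms(1)] by metis
  let ?n = "length ys"
  let ?A = "mat ?n ?n (\<lambda>(i, j). F (xs' ! i) (ys ! j))"
  have pp: "p permutes {0..<?n}" using p(1) len by (simp add: atLeast0LessThan)
  have lt: "p i < ?n" if "i < ?n" for i using permutes_in_image[OF pp, of i] that by auto
  have nth: "xs ! i = xs' ! p i" if "i < ?n" for i
    using permute_list_nth[OF p(1), of i] p(2) len that by simp
  have "mat ?n ?n (\<lambda>(i, j). F (xs ! i) (ys ! j)) = mat ?n ?n (\<lambda>(i, j). ?A $$ (p i, j))"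
    by (intro eq_matI) (simp_all add: nth lt)
  then have "det (mat ?n ?n (\<lambda>(i, j). F (xs ! i) (ys ! j))) = signof p * det ?A"
    using det_permute_rows[OF _ pp, of ?A] by simp
  then show ?thesis using assms(2) True len by (simp add: list_det_def)
next
  case False
  then show ?thesis by (simp add: list_det_def det_def)
qed

lemma list_det_permute_eq_0:
  assumes "mset xs = mset xs'" and "mset ys = mset ys'"
  shows "list_det F xs ys = 0 \<longleftrightarrow> list_det F xs' ys' = 0"
proof -
  have "list_det F xs ys = 0 \<longleftrightarrow> list_det F xs' ys = 0"
    using list_det_permute_rows_eq_0[OF assms(1)] list_det_permute_rows_eq_0[OF assms(1)[symmetric]]
    by blast
  also have "\<dots> \<longleftrightarrow> list_det F xs' ys' = 0"
    using list_det_permute_rows_eq_0[OF assms(2), of "\<lambda>y x. F x y" xs']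
      list_det_permute_rows_eq_0[OF assms(2)[symmetric], of "\<lambda>y x. F x y" xs']
    unfolding list_det_transpose[of F _ xs'] by blast
  finally show ?thesis .
qed

text \<open>In the Leibniz formula every term uses each row and each column exactly once, so the
  same product of factors comes out of all terms. The signs of reversed edges are later treated this
  way.\<close>

lemma list_det_scale:
  assumes "length xs = length ys"
  shows "list_det (\<lambda>x y. \<sigma> x * F x y * \<tau> y) xs ys
    = prod_list (map \<sigma> xs) * prod_list (map \<tau> ys) * list_det F xs ys"
proof -
  let ?n = "length ys"
  have *: "(\<Prod>i = 0..<?n. \<sigma> (xs ! i) * F (xs ! i) (ys ! p i) * \<tau> (ys ! p i))
      = prod_list (map \<sigma> xs) * prod_list (map \<tau> ys) * (\<Prod>i = 0..<?n. F (xs ! i) (ys ! p i))"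
    if p: "p permutes {0..<?n}" for p
  proof -
    have "(\<Prod>i = 0..<?n. \<tau> (ys ! p i)) = (\<Prod>i = 0..<?n. \<tau> (ys ! i))"
      using prod.permute[OF p, of "\<lambda>i. \<tau> (ys ! i)"] by (simp add: o_def)
    then show ?thesis
      by (simp add: prod.distrib prod.list_conv_set_nth assms mult_ac)
  qed
  have lt: "p i < ?n" if "p permutes {0..<?n}" "i < ?n" for p i
    using permutes_in_image[OF that(1), of i] that by auto
  show ?thesis
    unfolding list_det_def
    apply (subst (1 2) det_def'[of _ ?n])
      apply (simp_all add: assms sum_distrib_left)
    apply (rule sum.cong[OF HOL.refl])
    apply (simp add: lt *)
    done
qed

lemma list_det_expand_first_column:
  assumes "length xs = Suc (length ys)"
  shows "list_det F xs (y # ys) =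
    (\<Sum>i<length xs. F (xs ! i) y * ((- 1) ^ i * list_det F (take i xs @ drop (Suc i) xs) ys))"
proof -
  let ?n = "length xs"
  let ?A = "mat ?n ?n (\<lambda>(i, j). F (xs ! i) ((y # ys) ! j))"
  have "det ?A = (\<Sum>i<?n. ?A $$ (i, 0) * cofactor ?A i 0)"
    by (rule laplace_expansion_column) (use assms in auto)
  also have "\<dots> = (\<Sum>i<?n. F (xs ! i) y * ((- 1) ^ i * list_det F (take i xs @ drop (Suc i) xs) ys))"
  proof (rule sum.cong[OF HOL.refl])
    fix i assume "i \<in> {..<?n}"
    then have i: "i < ?n" by simp
    have "mat_delete ?A i 0 = mat (length (take i xs @ drop (Suc i) xs)) (length ys)
        (\<lambda>(i', j). F ((take i xs @ drop (Suc i) xs) ! i') (ys ! j))"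
      using i assms by (intro eq_matI) (auto simp: mat_delete_def nth_append min_def)
    then show "?A $$ (i, 0) * cofactor ?A i 0
        = F (xs ! i) y * ((- 1) ^ i * list_det F (take i xs @ drop (Suc i) xs) ys)"
      using i assms by (simp add: cofactor_def list_det_def)
  qed
  finally show ?thesis using assms by (simp add: list_det_def)
qed

text \<open>The determinant is affine in its top left entry. As neither \<open>x\<close> nor
  \<open>y\<close> recurs, the pair of labels marks that entry alone; this is how the variable of an
  edge gets isolated.\<close>

lemma list_det_expand_corner:
  assumes "length xs = length ys" and "x \<notin> set xs" and "y \<notin> set ys"
  shows "list_det F (x # xs) (y # ys) =
    F x y * list_det F xs ys
    + list_det (\<lambda>x' y'. if x' = x \<and> y' = y then 0 else F x' y') (x # xs) (y # ys)"
proof -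
  let ?G = "\<lambda>x' y'. if x' = x \<and> y' = y then 0 else F x' y'"
  have G: "list_det ?G zs ys = list_det F zs ys" for zs
    using assms by (intro list_det_cong) auto
  have "xs ! i \<noteq> x" if "i < length ys" for i using assms that by (metis nth_mem)
  then show ?thesis
    using assms(1)
    by (simp add: list_det_expand_first_column G sum.lessThan_Suc_shift del: sum.lessThan_Suc)
qed

lemma list_det_single_entry_column:
  assumes "length xs = length ys" and "\<And>x'. x' \<in> set xs \<Longrightarrow> F x' y = 0"
  shows "list_det F (x # xs) (y # ys) = F x y * list_det F xs ys"
  using assms
  by (simp add: list_det_expand_first_column sum.lessThan_Suc_shift del: sum.lessThan_Suc)

lemma list_det_repeated_column:
  assumes "length xs = Suc (length ys)" and "z \<in> set ys"
  shows "list_det F xs (z # ys) = 0"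
proof -
  obtain j where j: "j < length ys" "ys ! j = z" using assms(2) by (metis in_set_conv_nth)
  show ?thesis unfolding list_det_def
    by (rule det_identical_columns[of _ "length xs" 0 "Suc j"])
      (use assms j in \<open>auto intro!: eq_vecI\<close>)
qed

text \<open>The relation makes column \<open>y'\<close> equal to minus column \<open>y\<close> minus
  the columns of \<open>Z\<close>. The latter occur in \<open>ys\<close> already and contribute
  determinants with a repeated column.\<close>

lemma list_det_replace_column:
  assumes len: "length xs = Suc (length ys)" and Z: "Z \<subseteq> set ys"
    and rel: "\<And>x. x \<in> set xs \<Longrightarrow> F x y + F x y' + (\<Sum>z\<in>Z. F x z) = 0"
  shows "list_det F xs (y' # ys) = - list_det F xs (y # ys)"
proof -
  define c where "c i = (- 1) ^ i * list_det F (take i xs @ drop (Suc i) xs) ys" for i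
  have exp: "list_det F xs (z # ys) = (\<Sum>i<length xs. F (xs ! i) z * c i)" for z
    unfolding c_def by (rule list_det_expand_first_column[OF len])
  have "list_det F xs (y # ys) + list_det F xs (y' # ys) + (\<Sum>z\<in>Z. list_det F xs (z # ys))
      = (\<Sum>i<length xs. (F (xs ! i) y + F (xs ! i) y' + (\<Sum>z\<in>Z. F (xs ! i) z)) * c i)"
    unfolding exp sum.swap[of _ "{..<length xs}" Z]
    by (simp add: sum.distrib sum_distrib_right distrib_right)
  also have "\<dots> = 0" using rel by simp
  finally show ?thesis
    using Z list_det_repeated_column[OF len, of _ F]
    by (simp add: subset_iff eq_neg_iff_add_eq_0 add.commute)
qed

lemma list_det_replace_row:
  assumes "length ys = Suc (length xs)" and "Z \<subseteq> set xs"
    and "\<And>y. y \<in> set ys \<Longrightarrow> F x y + F x' y + (\<Sum>z\<in>Z. F z y) = 0"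
  shows "list_det F (x' # xs) ys = - list_det F (x # xs) ys"
  using list_det_replace_column[of ys xs Z "\<lambda>y x. F x y" x x'] assms
  unfolding list_det_transpose[of F ys] by blast

section \<open>Polynomials in which a given variable does not occur\<close>

definition free_of :: "'e \<Rightarrow> 'e poly_in \<Rightarrow> bool" where
  "free_of e p \<longleftrightarrow> (\<forall>m\<in>Poly_Mapping.keys p. Poly_Mapping.lookup m e = 0)"

lemma free_of_0: "free_of e 0"
  and free_of_1: "free_of e 1"
  and free_of_uminus: "free_of e p \<Longrightarrow> free_of e (- p)"
  by (auto simp: free_of_def)

lemma free_of_edge_var: "f \<noteq> e \<Longrightarrow> free_of e (edge_var f)"
  by (simp add: free_of_def edge_var_def lookup_single)

lemma free_of_add: "free_of e p \<Longrightarrow> free_of e q \<Longrightarrow> free_of e (p + q)"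
  unfolding free_of_def using keys_add[of p q] by blast

lemma free_of_mult: "free_of e p \<Longrightarrow> free_of e q \<Longrightarrow> free_of e (p * q)"
  unfolding free_of_def using keys_mult[of p q] by (fastforce simp: lookup_add)

lemma free_of_sum: "(\<And>i. i \<in> A \<Longrightarrow> free_of e (f i)) \<Longrightarrow> free_of e (\<Sum>i\<in>A. f i)"
  by (induction A rule: infinite_finite_induct) (auto simp: free_of_0 intro: free_of_add)

lemma free_of_prod: "(\<And>i. i \<in> A \<Longrightarrow> free_of e (f i)) \<Longrightarrow> free_of e (\<Prod>i\<in>A. f i)"
  by (induction A rule: infinite_finite_induct) (auto simp: free_of_1 intro: free_of_mult)

lemma free_of_list_det:
  assumes "\<And>x y. x \<in> set xs \<Longrightarrow> y \<in> set ys \<Longrightarrow> free_of e (F x y)"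
  shows "free_of e (list_det F xs ys)"
proof (cases "length xs = length ys")
  case True
  have lt: "p i < length ys" if "p permutes {0..<length ys}" "i < length ys" for p i
    using permutes_in_image[OF that(1), of i] that by auto
  show ?thesis
    unfolding list_det_def det_def using True lt assms
    by (auto intro!: free_of_sum free_of_mult free_of_prod
        simp: sign_def free_of_1 free_of_uminus)
next
  case False
  then show ?thesis by (simp add: list_det_def det_def free_of_0)
qed

text \<open>Multiplying by a variable shifts the exponents, so the coefficients of \<open>p\<close>
  can be read off from the product.\<close>

lemma lookup_edge_var_mult:
  "Poly_Mapping.lookup (edge_var e * p) (Poly_Mapping.single e 1 + m) = Poly_Mapping.lookup p m"
proof -
  have "(if b then 1 else 0) * z = (z when b)" for b and z :: int by (simp add: when_def)
  then show ?thesis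
    by (simp add: edge_var_def times_poly_mapping.rep_eq prod_fun_def lookup_single)
qed

text \<open>Every monomial of \<open>edge_var e * p\<close> has positive degree in \<open>e\<close>
  and every monomial of \<open>q\<close> has degree 0, so nothing can cancel between the two
  summands.\<close>

lemma edge_var_mult_add_eq_0:
  assumes "edge_var e * p + q = 0" and q: "free_of e q"
  shows "p = 0" and "q = 0"
proof -
  have "Poly_Mapping.keys q \<inter> Poly_Mapping.keys (edge_var e * p) = {}"
  proof -
    have "Poly_Mapping.lookup m e > 0" if "m \<in> Poly_Mapping.keys (edge_var e * p)" for m
      using keys_mult[of "edge_var e" p] that by (auto simp: edge_var_def lookup_add)
    then show ?thesis using q by (force simp: free_of_def)
  qed
  moreover have "q = - (edge_var e * p)" using assms(1) by (simp add: eq_neg_iff_add_eq_0 add.commute)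
  ultimately have "Poly_Mapping.keys q = {}" by simp
  then show "q = 0" by simp
  then have "edge_var e * p = 0" using assms(1) by simp
  then have "Poly_Mapping.lookup p m = 0" for m
    by (simp flip: lookup_edge_var_mult[of e p])
  then show "p = 0" by (intro poly_mapping_eqI) simp
qed

section \<open>Determinants of the graph matrix and their independence of the choices\<close>

text \<open>The diagonal and the two edge lists are arguments in place of \<open>I\<close>,
  \<open>J\<close> and \<open>K\<close>, so that an edge can be put in front and its variable
  replaced by 0.\<close>

definition graph_det ::
    "('e \<Rightarrow> 'v) \<Rightarrow> ('e \<Rightarrow> 'v) \<Rightarrow> ('e \<Rightarrow> 'e poly_in) \<Rightarrow> 'e list \<Rightarrow> 'e list \<Rightarrow> 'v list \<Rightarrow> 'e poly_in"
  where
  "graph_det src tgt a es fs vs =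
    list_det (graph_matrix src tgt a) (map Inl es @ map Inr vs) (map Inl fs @ map Inr vs)"

lemma dodgson_det_eq_graph_det:
  "dodgson_det (src, tgt, es, vs) I J K =
    graph_det src tgt (\<lambda>e. if e \<in> K then 0 else edge_var e)
      (filter (\<lambda>e. e \<notin> I) es) (filter (\<lambda>e. e \<notin> J) es) vs"
  by (simp add: dodgson_det_def graph_det_def list_det_def Let_def)

lemma graph_det_permute_eq_0:
  assumes "mset es = mset es'" and "mset fs = mset fs'" and "mset vs = mset vs'"
  shows "graph_det src tgt a es fs vs = 0 \<longleftrightarrow> graph_det src tgt a es' fs' vs' = 0"
  unfolding graph_det_def using assms by (intro list_det_permute_eq_0) simp_all

text \<open>Reversing an edge negates its incidences, in its row as well as in its column, while the
  diagonal entry is multiplied by the square of the sign.\<close>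

lemma graph_det_orientation_eq_0:
  fixes src tgt src' tgt' :: "'e \<Rightarrow> 'v"
  assumes len: "length es = length fs"
    and ends: "\<And>e. e \<in> set es \<union> set fs \<Longrightarrow> {src e, tgt e} = {src' e, tgt' e}"
    and zero: "graph_det src' tgt' a es fs vs = 0"
  shows "graph_det src tgt a es fs vs = 0"
proof -
  \<comment> \<open>Since the sets of ends agree, comparing sources decides whether the edge is
    reversed; a loop gets sign 1.\<close>
  define \<sigma> :: "'e + 'v \<Rightarrow> 'e poly_in" where
    "\<sigma> = case_sum (\<lambda>e. if src e = src' e then 1 else - 1) (\<lambda>v. 1)"
  have inc: "incidence src tgt e v = \<sigma> (Inl e) * incidence src' tgt' e v"
    if "e \<in> set es \<union> set fs" for e v
  proof -
    have "src e = src' e \<and> tgt e = tgt' e \<or> src e = tgt' e \<and> tgt e = src' e"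
      using ends[OF that] unfolding doubleton_eq_iff .
    then show ?thesis unfolding \<sigma>_def incidence_def by (elim disjE conjE) simp_all
  qed
  have \<sigma>: "\<sigma> (Inr v) = 1" "\<sigma> (Inl e) * (p * \<sigma> (Inl e)) = p" for v e p
    by (auto simp: \<sigma>_def)
  have "graph_matrix src tgt a x y = \<sigma> x * graph_matrix src' tgt' a x y * \<sigma> y"
    if "x \<in> set (map Inl es @ map Inr vs)" "y \<in> set (map Inl fs @ map Inr vs)" for x y
    using that by (cases x rule: sum.exhaust; cases y rule: sum.exhaust) (auto simp: inc \<sigma> mult.commute)
  then have "graph_det src tgt a es fs vs =
      list_det (\<lambda>x y. \<sigma> x * graph_matrix src' tgt' a x y * \<sigma> y)
        (map Inl es @ map Inr vs) (map Inl fs @ map Inr vs)"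
    unfolding graph_det_def by (intro list_det_cong)
  then show ?thesis
    using zero len by (subst (asm) list_det_scale) (simp_all add: graph_det_def)
qed

lemma sum_incidence:
  assumes "finite V" and "src e \<in> V" and "tgt e \<in> V"
  shows "(\<Sum>v\<in>V. incidence src tgt e v) = 0"
proof (cases "src e = tgt e")
  case False
  have "(\<Sum>v\<in>V. incidence src tgt e v)
      = (\<Sum>v\<in>V. (if v = src e then 1 else 0) - (if v = tgt e then 1 else 0))"
    using False by (intro sum.cong) (auto simp: incidence_def)
  then show ?thesis using assms by (simp add: sum_subtractf)
qed (simp add: incidence_def)

text \<open>All rows and all columns of the full incidence block sum to zero over the vertices, so
  exchanging the omitted vertex only changes the sign, once for the columns and once for the rows.\<close>

lemma graph_det_omitted_vertex_eq_0:
  assumes len: "length es = length fs"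
    and d: "distinct (r # r' # vs)"
    and ends: "\<And>e. e \<in> set es \<union> set fs \<Longrightarrow> src e \<in> set (r # r' # vs) \<and> tgt e \<in> set (r # r' # vs)"
    and zero: "graph_det src tgt a es fs (r # vs) = 0"
  shows "graph_det src tgt a es fs (r' # vs) = 0"
proof -
  let ?F = "graph_matrix src tgt a"
  let ?xs = "map Inl es @ map Inr vs" and ?ys = "map Inl fs @ map Inr vs"
  have sum0: "incidence src tgt e r + incidence src tgt e r'
      + (\<Sum>z\<in>set vs. incidence src tgt e z) = 0" if "e \<in> set es \<union> set fs" for e
    using sum_incidence[of "set (r # r' # vs)" src e tgt] ends[OF that] d by (simp add: add.assoc)
  have sumZ: "(\<Sum>z\<in>Inr ` set vs. g z) = (\<Sum>z\<in>set vs. g (Inr z))" for g :: "_ \<Rightarrow> _ poly_in"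
    by (subst sum.reindex) (auto simp: inj_on_def)
  \<comment> \<open>The vertex being exchanged is moved to the front, where rows and columns can be
    replaced.\<close>
  have front: "graph_det src tgt a es fs (v # vs) = 0
      \<longleftrightarrow> list_det ?F (Inr v # ?xs) (Inr v # ?ys) = 0" for v
    unfolding graph_det_def by (intro list_det_permute_eq_0) simp_all
  \<comment> \<open>The vertex rows of the matrix carry the negated incidences, so the row exchange
    needs the relation in this form.\<close>
  have sum1: "- incidence src tgt e r - incidence src tgt e r' = (\<Sum>z\<in>set vs. incidence src tgt e z)"
    if "e \<in> set es \<union> set fs" for e
  proof -
    have "- incidence src tgt e r - incidence src tgt e r'
        = - (incidence src tgt e r + incidence src tgt e r')" by simp
    also have "\<dots> = (\<Sum>z\<in>set vs. incidence src tgt e z)"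
      using sum0[OF that] by (simp only: neg_eq_iff_add_eq_0)
    finally show ?thesis .
  qed
  \<comment> \<open>The intermediate matrix is mixed: \<open>r\<close> still labels a row while
    \<open>r'\<close> already labels a column.\<close>
  have "list_det ?F (Inr r # ?xs) (Inr r' # ?ys) = - list_det ?F (Inr r # ?xs) (Inr r # ?ys)"
  proof (rule list_det_replace_column[where Z = "Inr ` set vs"])
    fix x assume "x \<in> set (Inr r # ?xs)"
    then show "?F x (Inr r) + ?F x (Inr r') + (\<Sum>z\<in>Inr ` set vs. ?F x z) = 0"
      unfolding sumZ by (auto simp: sum0)
  qed (use len in auto)
  moreover have "list_det ?F (Inr r' # ?xs) (Inr r' # ?ys) = - list_det ?F (Inr r # ?xs) (Inr r' # ?ys)"
  proof (rule list_det_replace_row[where Z = "Inr ` set vs"])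
    fix y assume "y \<in> set (Inr r' # ?ys)"
    then show "?F (Inr r) y + ?F (Inr r') y + (\<Sum>z\<in>Inr ` set vs. ?F z y) = 0"
      unfolding sumZ
      by (auto simp: sum1 sum_negf)
  qed (use len in auto)
  ultimately show ?thesis using zero by (simp add: front)
qed

lemma length_filter_notin:
  assumes "distinct es" and "X \<subseteq> set es"
  shows "length (filter (\<lambda>e. e \<notin> X) es) = length es - card X"
proof -
  have "length (filter (\<lambda>e. e \<notin> X) es) = card (set (filter (\<lambda>e. e \<notin> X) es))"
    using assms(1) by (simp add: distinct_card del: set_filter)
  also have "set (filter (\<lambda>e. e \<notin> X) es) = set es - X" by auto
  finally show ?thesis
    using assms by (simp add: card_Diff_subset finite_subset distinct_card)
qed

lemma ends_in_verts:
  assumes "multigraph G" and "e \<in> edges G" and "ends G e = {s, t}"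
  shows "s \<in> verts G" and "t \<in> verts G"
proof -
  have "ends G e \<subseteq> verts G" using assms(1,2) by (simp add: multigraph_def)
  then show "s \<in> verts G" and "t \<in> verts G" using assms(3) by simp_all
qed

text \<open>The choices are exchanged one kind at a time: first the order of the edges, then the
  orientation, then the omitted vertex together with the order of the vertices. One implication
  suffices because the two choices play symmetric roles.\<close>

lemma dodgson_det_eq_0_choice:
  assumes G: "multigraph G"
    and IJ: "I \<subseteq> edges G" "J \<subseteq> edges G" "card I = card J"
    and c: "admissible_choice G (src, tgt, es, vs)"
    and c': "admissible_choice G (src', tgt', es', vs')"
    and zero: "dodgson_det (src', tgt', es', vs') I J K = 0"
  shows "dodgson_det (src, tgt, es, vs) I J K = 0"
proof -
  let ?a = "\<lambda>e. if e \<in> K then 0 else edge_var e :: _ poly_in"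
  let ?es = "filter (\<lambda>e. e \<notin> I) es" and ?fs = "filter (\<lambda>e. e \<notin> J) es"
  from c obtain r where r: "r \<in> verts G" "set vs = verts G - {r}" "distinct vs"
    and es: "distinct es" "set es = edges G" and ends: "\<forall>e\<in>edges G. ends G e = {src e, tgt e}"
    by (auto simp: admissible_choice_def)
  from c' obtain r' where r': "r' \<in> verts G" "set vs' = verts G - {r'}" "distinct vs'"
    and es': "distinct es'" "set es' = edges G"
    and ends': "\<forall>e\<in>edges G. ends G e = {src' e, tgt' e}"
    by (auto simp: admissible_choice_def)
  have len: "length ?es = length ?fs"
    using es IJ by (simp add: length_filter_notin)
  have mset: "mset es = mset es'" using es es' set_eq_iff_mset_eq_distinct[of es es'] by simp
  have inV: "src e \<in> verts G \<and> tgt e \<in> verts G" if "e \<in> edges G" for e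
    using that ends ends_in_verts[OF G] by blast
  have "graph_det src' tgt' ?a ?es ?fs vs' = 0"
    using zero mset unfolding dodgson_det_eq_graph_det
    by (subst graph_det_permute_eq_0[where es' = "filter (\<lambda>e. e \<notin> I) es'"
          and fs' = "filter (\<lambda>e. e \<notin> J) es'" and vs' = vs']) simp_all
  then have zero': "graph_det src tgt ?a ?es ?fs vs' = 0"
    using graph_det_orientation_eq_0[OF len, of src tgt src' tgt'] ends ends' es by auto
  have "graph_det src tgt ?a ?es ?fs vs = 0"
  proof (cases "r = r'")
    case True
    have vs: "mset vs = mset vs'" using True r r' set_eq_iff_mset_eq_distinct[of vs vs'] by simp
    show ?thesis using zero' graph_det_permute_eq_0[OF HOL.refl HOL.refl vs] by blast
  next
    case False
    \<comment> \<open>\<open>ws\<close> is the common part of both vertex lists: up to order,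
      \<open>vs\<close> is \<open>r' # ws\<close> and \<open>vs'\<close> is
      \<open>r # ws\<close>.\<close>
    define ws where "ws = remove1 r' vs"
    have ws: "set ws = verts G - {r, r'}" "distinct ws" using r by (auto simp: ws_def)
    have vs: "mset vs = mset (r' # ws)"
      using r r' ws False set_eq_iff_mset_eq_distinct[of vs "r' # ws"] by auto
    have vs': "mset vs' = mset (r # ws)"
      using r r' ws False set_eq_iff_mset_eq_distinct[of vs' "r # ws"] by auto
    have "graph_det src tgt ?a ?es ?fs (r # ws) = 0"
      using zero' graph_det_permute_eq_0[OF HOL.refl HOL.refl vs'] by blast
    then have "graph_det src tgt ?a ?es ?fs (r' # ws) = 0"
    proof (rule graph_det_omitted_vertex_eq_0[OF len, rotated 2])
      show "distinct (r # r' # ws)" using False ws by simp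
      have "set (r # r' # ws) = verts G" using ws(1) r(1) r'(1) by auto
      then show "src e \<in> set (r # r' # ws) \<and> tgt e \<in> set (r # r' # ws)"
        if "e \<in> set ?es \<union> set ?fs" for e
        using inV[of e] that es(2) by auto
    qed
    then show ?thesis using graph_det_permute_eq_0[OF HOL.refl HOL.refl vs] by blast
  qed
  then show ?thesis by (simp add: dodgson_det_eq_graph_det)
qed

text \<open>Frees later arguments from the representative picked by \<open>SOME\<close>: vanishing
  can be tested on the most convenient choice.\<close>

lemma dodgson_poly_eq_0_iff:
  assumes G: "multigraph G"
    and IJ: "I \<subseteq> edges G" "J \<subseteq> edges G" "card I = card J"
    and c: "admissible_choice G c"
  shows "dodgson_poly G I J K = 0 \<longleftrightarrow> dodgson_det c I J K = 0"
proof -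
  have imp: "dodgson_det d I J K = 0"
    if "admissible_choice G d" "admissible_choice G d'" "dodgson_det d' I J K = 0" for d d'
    using dodgson_det_eq_0_choice[OF G IJ] that by (cases d; cases d') blast
  have "admissible_choice G (SOME c. admissible_choice G c)" using c by (rule someI)
  from imp[OF this c] imp[OF c this] show ?thesis unfolding dodgson_poly_def by blast
qed

section \<open>Removing one edge from the determinant\<close>

text \<open>The variable of \<open>e\<close> occurs only in the corner entry. Expanding there writes
  the determinant as \<open>edge_var e\<close> times a minor plus a term free of \<open>e\<close>,
  so both parts vanish. The minor serves deletion, the other term contraction.\<close>

lemma graph_det_edge_eq_0:
  assumes len: "length es = length fs" and e: "e \<notin> set es" "e \<notin> set fs"
    and a: "a e = edge_var e" "\<And>f. f \<noteq> e \<Longrightarrow> free_of e (a f)"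
    and zero: "graph_det src tgt a (e # es) (e # fs) vs = 0"
  shows "graph_det src tgt a es fs vs = 0"
    and "graph_det src tgt (a(e := 0)) (e # es) (e # fs) vs = 0"
proof -
  let ?xs = "map Inl es @ map Inr vs" and ?ys = "map Inl fs @ map Inr vs"
  let ?F0 = "\<lambda>x y. if x = Inl e \<and> y = Inl e then 0 else graph_matrix src tgt a x y"
  have F0: "?F0 = graph_matrix src tgt (a(e := 0))"
  proof (intro ext)
    show "?F0 x y = graph_matrix src tgt (a(e := 0)) x y" for x y
      by (cases x rule: sum.exhaust; cases y rule: sum.exhaust) simp_all
  qed
  have free: "free_of e (graph_matrix src tgt (a(e := 0)) x y)" for x y
    using a(2) by (cases x rule: sum.exhaust; cases y rule: sum.exhaust)
      (simp_all add: incidence_def free_of_0 free_of_1 free_of_uminus)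
  have "edge_var e * list_det (graph_matrix src tgt a) ?xs ?ys
      + list_det ?F0 (Inl e # ?xs) (Inl e # ?ys) = 0"
    using list_det_expand_corner[of ?xs ?ys "Inl e" "Inl e" "graph_matrix src tgt a"]
      len e zero a(1) by (simp add: graph_det_def image_iff)
  moreover have "free_of e (list_det ?F0 (Inl e # ?xs) (Inl e # ?ys))"
    unfolding F0 by (rule free_of_list_det[OF free])
  ultimately have "list_det (graph_matrix src tgt a) ?xs ?ys = 0"
    and "list_det ?F0 (Inl e # ?xs) (Inl e # ?ys) = 0"
    by (rule edge_var_mult_add_eq_0)+
  then show "graph_det src tgt a es fs vs = 0"
    and "graph_det src tgt (a(e := 0)) (e # es) (e # fs) vs = 0"
    by (simp_all add: graph_det_def F0)
qed

text \<open>With the end \<open>w\<close> of \<open>e\<close> omitted, the row and the column of \<open>e\<close> have their only nonzero entry,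
  a sign, at the other end \<open>u\<close>; expanding along both removes \<open>e\<close> and \<open>u\<close>.\<close>

lemma graph_det_contract_eq_0:
  assumes len: "length es = length fs" and e: "e \<notin> set es" "e \<notin> set fs"
    and uw: "{src e, tgt e} = {u, w}" "u \<noteq> w" "u \<notin> set vs" "w \<notin> set vs"
    and a: "a e = 0"
    and zero: "graph_det src tgt a (e # es) (e # fs) (u # vs) = 0"
  shows "graph_det src tgt a es fs vs = 0"
proof -
  let ?F = "graph_matrix src tgt a"
  let ?xs = "map Inl es @ map Inr vs" and ?ys = "map Inl fs @ map Inr vs"
  have ends: "src e = u \<and> tgt e = w \<or> src e = w \<and> tgt e = u"
    using uw(1) unfolding doubleton_eq_iff .
  have inc0: "incidence src tgt e v = 0" if "v \<in> set vs" for v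
  proof -
    have "v \<noteq> u" "v \<noteq> w" using that uw(3,4) by blast+
    then show ?thesis using ends unfolding incidence_def by (elim disjE conjE) simp_all
  qed
  have inc1: "incidence src tgt e u = 1 \<or> incidence src tgt e u = - 1"
    using ends uw(2) unfolding incidence_def by (elim disjE conjE) simp_all
  \<comment> \<open>The row of \<open>u\<close> comes before that of \<open>e\<close>, but the
    column of \<open>e\<close> before that of \<open>u\<close>. Each of the two single entries then
    sits in a top left corner when its turn comes.\<close>
  have "list_det ?F (Inr u # Inl e # ?xs) (Inl e # Inr u # ?ys) = 0"
    using zero unfolding graph_det_def
    by (subst list_det_permute_eq_0[where xs' = "map Inl (e # es) @ map Inr (u # vs)"
          and ys' = "map Inl (e # fs) @ map Inr (u # vs)"]) simp_all
  moreover have "list_det ?F (Inr u # Inl e # ?xs) (Inl e # Inr u # ?ys)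
      = - incidence src tgt e u * list_det ?F (Inl e # ?xs) (Inr u # ?ys)"
    using e len by (subst list_det_single_entry_column) (auto simp: inc0 a)
  moreover have "list_det ?F (Inl e # ?xs) (Inr u # ?ys) = incidence src tgt e u * list_det ?F ?xs ?ys"
  proof -
    have "?F (Inl e) y = 0" if "y \<in> set ?ys" for y using that e by (auto simp: inc0 a)
    then show ?thesis
      using list_det_single_entry_column[of ?ys ?xs "\<lambda>y x. ?F x y" "Inl e" "Inr u"] len
      unfolding list_det_transpose[of ?F "Inr u # ?ys"] list_det_transpose[of ?F ?ys] by simp
  qed
  \<comment> \<open>The total factor is minus the square of a sign, hence -1.\<close>
  ultimately show ?thesis using inc1 by (auto simp: graph_det_def)
qed

text \<open>Vertices enter only through their incidences with the listed edges. This carries a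
  determinant of the original graph over to the contracted one, with \<phi> the quotient
  map.\<close>

lemma graph_det_relabel:
  assumes "\<And>f v. f \<in> set es \<union> set fs \<Longrightarrow> v \<in> set vs \<Longrightarrow>
    incidence src' tgt' f (\<phi> v) = incidence src tgt f v"
  shows "graph_det src' tgt' a es fs (map \<phi> vs) = graph_det src tgt a es fs vs"
proof -
  let ?\<phi> = "map_sum id \<phi>"
  have \<phi>: "map Inl hs @ map Inr (map \<phi> vs) = map ?\<phi> (map Inl hs @ map Inr vs)" for hs
    by simp
  have "graph_det src' tgt' a es fs (map \<phi> vs)
      = list_det (\<lambda>x y. graph_matrix src' tgt' a (?\<phi> x) (?\<phi> y))
          (map Inl es @ map Inr vs) (map Inl fs @ map Inr vs)"
    unfolding graph_det_def \<phi> by (rule list_det_map)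
  also have "\<dots> = graph_det src tgt a es fs vs"
    unfolding graph_det_def
  proof (rule list_det_cong)
    fix x y
    assume "x \<in> set (map Inl es @ map Inr vs)" "y \<in> set (map Inl fs @ map Inr vs)"
    then show "graph_matrix src' tgt' a (?\<phi> x) (?\<phi> y) = graph_matrix src tgt a x y"
      using assms by (cases x rule: sum.exhaust; cases y rule: sum.exhaust) auto
  qed
  finally show ?thesis .
qed

lemma graph_det_update_other:
  assumes "e \<notin> set es"
  shows "graph_det src tgt (a(e := p)) es fs vs = graph_det src tgt a es fs vs"
  unfolding graph_det_def
proof (rule list_det_cong)
  fix x y assume "x \<in> set (map Inl es @ map Inr vs)"
  then show "graph_matrix src tgt (a(e := p)) x y = graph_matrix src tgt a x y"
    using assms by (cases x rule: sum.exhaust; cases y rule: sum.exhaust) auto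
qed

section \<open>Dodgson polynomials under deletion and contraction\<close>

text \<open>Common start of both cases: independence of the choices allows \<open>e\<close> to head
  the edge list. The omitted vertex \<open>r\<close> stays a parameter, so that contraction can take
  an end of \<open>e\<close> for it.\<close>

lemma dodgson_poly_edge_eq_0:
  assumes G: "multigraph G" and e: "e \<in> edges G" "e \<notin> K"
    and IJ: "I \<subseteq> edges G - {e}" "J \<subseteq> edges G - {e}" "card I = card J"
    and zero: "dodgson_poly G I J K = 0"
    and ends: "\<forall>f\<in>edges G. ends G f = {src f, tgt f}"
    and es: "distinct es" "set es = edges G - {e}"
    and vs: "distinct vs" "set vs = verts G - {r}" "r \<in> verts G"
  defines "a \<equiv> \<lambda>f. if f \<in> K then 0 else edge_var f"
    and "es\<^sub>I \<equiv> filter (\<lambda>f. f \<notin> I) es" and "es\<^sub>J \<equiv> filter (\<lambda>f. f \<notin> J) es"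
  shows "graph_det src tgt a es\<^sub>I es\<^sub>J vs = 0"
    and "graph_det src tgt (a(e := 0)) (e # es\<^sub>I) (e # es\<^sub>J) vs = 0"
proof -
  have "admissible_choice G (src, tgt, e # es, vs)"
    using ends es vs e by (auto simp: admissible_choice_def)
  then have "dodgson_det (src, tgt, e # es, vs) I J K = 0"
    using dodgson_poly_eq_0_iff[OF G _ _ IJ(3)] IJ(1,2) zero Diff_subset order_trans by metis
  moreover have "e \<notin> I" "e \<notin> J" using IJ by auto
  ultimately have *: "graph_det src tgt a (e # es\<^sub>I) (e # es\<^sub>J) vs = 0"
    by (simp add: dodgson_det_eq_graph_det a_def es\<^sub>I_def es\<^sub>J_def)
  have len: "length es\<^sub>I = length es\<^sub>J"
    using es IJ by (simp add: es\<^sub>I_def es\<^sub>J_def length_filter_notin)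
  have e': "e \<notin> set es\<^sub>I" "e \<notin> set es\<^sub>J" "a e = edge_var e"
    using es e by (auto simp: es\<^sub>I_def es\<^sub>J_def a_def)
  have free: "free_of e (a f)" if "f \<noteq> e" for f
    using that by (simp add: a_def free_of_0 free_of_edge_var)
  show "graph_det src tgt a es\<^sub>I es\<^sub>J vs = 0"
    and "graph_det src tgt (a(e := 0)) (e # es\<^sub>I) (e # es\<^sub>J) vs = 0"
    by (rule graph_det_edge_eq_0[OF len e' free *]; assumption)+
qed

lemma multigraph_labelling:
  assumes G: "multigraph G" and e: "e \<in> edges G"
  obtains src tgt es where "\<forall>f\<in>edges G. ends G f = {src f, tgt f}"
    and "distinct es" and "set es = edges G - {e}"
proof -
  \<comment> \<open>An edge supplies a vertex, which an admissible choice needs.\<close>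
  have "ends G e \<noteq> {}" "ends G e \<subseteq> verts G" using G e by (auto simp: multigraph_def)
  then have "verts G \<noteq> {}" by blast
  from admissible_choice_exists[OF G this] obtain c where c: "admissible_choice G c" ..
  obtain src tgt es vs where "c = (src, tgt, es, vs)" by (cases c)
  then show thesis
    using c by (intro that[of src tgt "remove1 e es"]) (auto simp: admissible_choice_def)
qed

lemma multigraph_delete_edge: "multigraph G \<Longrightarrow> multigraph (delete_edge G e)"
  by (auto simp: multigraph_def delete_edge_def)

text \<open>The image of a nonempty set of at most two ends again has one or two elements; edges
  parallel to a contracted non-loop become loops.\<close>

lemma multigraph_contracts_to:
  assumes "multigraph G" and "contracts_to G e H"
  shows "multigraph H"
proof -
  obtain \<phi> where \<phi>: "verts H = \<phi> ` verts G" "edges H = edges G - {e}"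
    "\<forall>f\<in>edges H. ends H f = \<phi> ` ends G f"
    using assms(2) by (auto simp: contracts_to_def)
  have "card (ends H f) = 1 \<or> card (ends H f) = 2" if f: "f \<in> edges H" for f
  proof -
    have c: "card (ends G f) = 1 \<or> card (ends G f) = 2"
      using assms(1) f \<phi>(2) by (auto simp: multigraph_def)
    then have "finite (ends G f)" "ends G f \<noteq> {}" by (auto intro: card_ge_0_finite)
    then have "card (\<phi> ` ends G f) \<noteq> 0" "card (\<phi> ` ends G f) \<le> card (ends G f)"
      by (auto intro: card_image_le)
    then show ?thesis using c \<phi>(3) f by auto
  qed
  then show ?thesis
    using assms(1) \<phi> by (fastforce simp: multigraph_def)
qed

lemma dodgson_poly_delete_edge_eq_0:
  assumes G: "multigraph G" and e: "e \<in> edges G" "e \<notin> K"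
    and IJ: "I \<subseteq> edges G - {e}" "J \<subseteq> edges G - {e}" "card I = card J"
    and zero: "dodgson_poly G I J K = 0"
  shows "dodgson_poly (delete_edge G e) I J K = 0"
proof -
  obtain src tgt es where ends: "\<forall>f\<in>edges G. ends G f = {src f, tgt f}"
    and es: "distinct es" "set es = edges G - {e}"
    by (rule multigraph_labelling[OF G e(1)])
  obtain r where r: "r \<in> verts G" using ends_in_verts[OF G e(1)] ends e(1) by blast
  obtain vs where vs: "distinct vs" "set vs = verts G - {r}"
    using G finite_distinct_list[of "verts G - {r}"] by (auto simp: multigraph_def)
  have "admissible_choice (delete_edge G e) (src, tgt, es, vs)"
    using ends es vs r by (auto simp: admissible_choice_def delete_edge_def)
  moreover have "dodgson_det (src, tgt, es, vs) I J K = 0"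
    unfolding dodgson_det_eq_graph_det
    by (rule dodgson_poly_edge_eq_0(1)[OF G e IJ zero ends es vs r])
  moreover have IJ': "I \<subseteq> edges (delete_edge G e)" "J \<subseteq> edges (delete_edge G e)"
    using IJ by (simp_all add: delete_edge_def)
  ultimately show ?thesis
    using dodgson_poly_eq_0_iff[OF multigraph_delete_edge[OF G] IJ' IJ(3)] by blast
qed

text \<open>The list \<open>vs\<close> leaves out both ends of \<open>e\<close>. Its image under
  \<phi> lists all vertices of \<open>H\<close> except the merged one, which is the vertex omitted
  for \<open>H\<close>.\<close>

lemma dodgson_poly_contract_eq_0:
  assumes G: "multigraph G" and H: "contracts_to G e H" and eK: "e \<notin> K"
    and IJ: "I \<subseteq> edges H" "J \<subseteq> edges H" "card I = card J"
    and zero: "dodgson_poly G I J K = 0"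
  shows "dodgson_poly H I J K = 0"
proof -
  let ?a = "\<lambda>f. if f \<in> K then 0 else edge_var f :: _ poly_in"
  obtain \<phi> where e: "e \<in> edges G" and edH: "edges H = edges G - {e}"
    and vH: "verts H = \<phi> ` verts G"
    and eq: "\<forall>x\<in>verts G. \<forall>y\<in>verts G. \<phi> x = \<phi> y \<longleftrightarrow> x = y \<or> {x, y} = ends G e"
    and endsH: "\<forall>f\<in>edges H. ends H f = \<phi> ` ends G f"
    using H unfolding contracts_to_def by (elim conjE exE) (rule that; assumption)
  have \<phi>: "\<phi> x = \<phi> y \<longleftrightarrow> x = y \<or> {x, y} = ends G e" if "x \<in> verts G" "y \<in> verts G" for x y
    using eq that by simp
  note IJ' = IJ(1,2)[unfolded edH] IJ(3)
  obtain src tgt es where ends: "\<forall>f\<in>edges G. ends G f = {src f, tgt f}"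
    and es: "distinct es" "set es = edges G - {e}"
    by (rule multigraph_labelling[OF G e])
  let ?I = "filter (\<lambda>f. f \<notin> I) es" and ?J = "filter (\<lambda>f. f \<notin> J) es"
  have inV: "src f \<in> verts G" "tgt f \<in> verts G" if "f \<in> edges G" for f
    using that ends ends_in_verts[OF G] by blast+
  define u w where "u = src e" and "w = tgt e"
  have uw: "u \<in> verts G" "w \<in> verts G" "ends G e = {u, w}"
    using inV[OF e] ends e by (auto simp: u_def w_def)
  obtain vs where vs: "distinct vs" "set vs = verts G - {u, w}"
    using G finite_distinct_list[of "verts G - {u, w}"] by (auto simp: multigraph_def)
  \<comment> \<open>Only the ends of \<open>e\<close> are identified, so a vertex off
    \<open>e\<close> is determined by its image.\<close>
  have \<phi>_cancel: "\<phi> v = \<phi> x \<longleftrightarrow> v = x" if "v \<in> verts G - {u, w}" "x \<in> verts G" for v x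
    using \<phi>[of v x] uw(3) that by auto
  have "graph_det src tgt ?a ?I ?J vs = 0"
  \<comment> \<open>For a loop, \<open>vs\<close> omits a single vertex and the leading coefficient
    is used, as for deletion. Otherwise \<open>u # vs\<close> omits \<open>w\<close>, and the
    constant term is expanded further.\<close>
  proof (cases "u = w")
    case True
    show ?thesis
      by (rule dodgson_poly_edge_eq_0(1)[OF G e eK IJ' zero ends es vs(1) _ uw(2)])
        (use vs True in auto)
  next
    case False
    have "graph_det src tgt (?a(e := 0)) (e # ?I) (e # ?J) (u # vs) = 0"
      by (rule dodgson_poly_edge_eq_0(2)[OF G e eK IJ' zero ends es _ _ uw(2)])
        (use vs uw False in auto)
    then have "graph_det src tgt (?a(e := 0)) ?I ?J vs = 0"
      using es IJ' vs False
      by (intro graph_det_contract_eq_0[of ?I ?J e src tgt u w])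
        (auto simp: length_filter_notin u_def w_def)
    \<comment> \<open>Once \<open>e\<close> labels no row, its diagonal value is immaterial.\<close>
    then show ?thesis using es by (subst (asm) graph_det_update_other) auto
  qed
  moreover have "incidence (\<phi> \<circ> src) (\<phi> \<circ> tgt) f (\<phi> v) = incidence src tgt f v"
    if "f \<in> edges G" "v \<in> verts G - {u, w}" for f v
  proof -
    have "\<phi> v = \<phi> (src f) \<longleftrightarrow> v = src f" "\<phi> v = \<phi> (tgt f) \<longleftrightarrow> v = tgt f"
      using inV[OF that(1)] that(2) by (simp_all only: \<phi>_cancel)
    \<comment> \<open>An edge that becomes a loop without having been one is parallel to
      \<open>e\<close>, hence has zero incidence at \<open>v\<close> already in
      \<open>G\<close>.\<close>
    moreover have "v \<noteq> src f \<and> v \<noteq> tgt f" if "\<phi> (src f) = \<phi> (tgt f)" "src f \<noteq> tgt f"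
    proof -
      have "{src f, tgt f} = {u, w}"
        using \<phi>[of "src f" "tgt f"] inV[OF \<open>f \<in> edges G\<close>] uw(3) that by blast
      then show ?thesis using \<open>v \<in> verts G - {u, w}\<close> by auto
    qed
    ultimately show ?thesis by (auto simp: incidence_def)
  qed
  ultimately have "graph_det (\<phi> \<circ> src) (\<phi> \<circ> tgt) ?a ?I ?J (map \<phi> vs) = 0"
    using es vs by (subst graph_det_relabel[where src = src and tgt = tgt]) auto
  then have "dodgson_det (\<phi> \<circ> src, \<phi> \<circ> tgt, es, map \<phi> vs) I J K = 0"
    by (simp add: dodgson_det_eq_graph_det)
  moreover have "admissible_choice H (\<phi> \<circ> src, \<phi> \<circ> tgt, es, map \<phi> vs)"
  proof -
    have "inj_on \<phi> (set vs)"
    proof (rule inj_onI)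
      fix x y assume "x \<in> set vs" "y \<in> set vs" "\<phi> x = \<phi> y"
      then show "x = y" using \<phi>_cancel[of x y] vs(2) by simp
    qed
    moreover have "\<phi> ` set vs = verts H - {\<phi> w}"
    proof (intro equalityI subsetI)
      fix y assume "y \<in> \<phi> ` set vs"
      then obtain v where "v \<in> verts G - {u, w}" "y = \<phi> v" unfolding vs(2) by blast
      then show "y \<in> verts H - {\<phi> w}" using \<phi>_cancel[of v w] uw(2) vH by simp
    next
      fix y assume "y \<in> verts H - {\<phi> w}"
      then obtain v where v: "v \<in> verts G" "y = \<phi> v" "\<phi> v \<noteq> \<phi> w" unfolding vH by blast
      have "\<phi> u = \<phi> w" using \<phi>[OF uw(1,2)] uw(3) by simp
      then have "v \<in> verts G - {u, w}" using v(1,3) by auto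
      then show "y \<in> \<phi> ` set vs" unfolding vs(2) v(2) by (rule imageI)
    qed
    moreover have "\<phi> w \<in> verts H" using uw vH by simp
    ultimately show ?thesis
      using ends endsH edH es vs(1) unfolding admissible_choice_def
      by (simp add: distinct_map) blast
  qed
  ultimately show ?thesis
    using dodgson_poly_eq_0_iff[OF multigraph_contracts_to[OF G H] IJ] by blast
qed

section \<open>From Dodgson polynomials to splitting, and induction over minors\<close>

text \<open>A configuration of \<open>H\<close> is also one of \<open>G\<close>, and the triple
  whose polynomial vanishes for \<open>G\<close> serves for \<open>H\<close> as well. As
  \<open>I\<close>, \<open>J\<close> and \<open>K\<close> lie in \<open>edges H\<close>, an edge
  removed from \<open>G\<close> belongs to none of them.\<close>

lemma splits_mono:
  assumes "splits G" and sub: "edges H \<subseteq> edges G"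
    and zero: "\<And>I J K. I \<subseteq> edges H \<Longrightarrow> J \<subseteq> edges H \<Longrightarrow> K \<subseteq> edges H \<Longrightarrow> card I = card J \<Longrightarrow>
      dodgson_poly G I J K = 0 \<Longrightarrow> dodgson_poly H I J K = 0"
  shows "splits H"
  unfolding splits_def
proof (intro allI impI)
  fix S assume S: "five_configuration H S"
  then have "config_splits G S"
    using assms(1) sub by (auto simp: splits_def five_configuration_def)
  then obtain I J K where IJK: "I \<union> J \<union> K = S" "K \<inter> (I \<union> J) = {}"
    "card I = 2 \<and> card J = 2 \<and> I \<inter> J = {} \<and> card K = 1 \<or>
     card I = 3 \<and> card J = 3 \<and> card (I \<inter> J) = 1 \<and> K = {}"
    and "dodgson_poly G I J K = 0"
    unfolding config_splits_def dodgson_polys_def by blast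
  moreover have "S \<subseteq> edges H" using S by (simp add: five_configuration_def)
  ultimately have "dodgson_poly H I J K = 0" by (intro zero) auto
  moreover have "dodgson_poly H I J K \<in> dodgson_polys H S"
    unfolding dodgson_polys_def using IJK by blast
  ultimately show "config_splits H S" unfolding config_splits_def by blast
qed

theorem theorem11:
  fixes G Gm :: "('v, 'e) pre_multigraph"
  assumes "multigraph G"
    and "splits G"
    and "minor_of Gm G"
  shows "splits Gm"
proof -
  \<comment> \<open>Being a multigraph is carried through the induction because each one-step lemma
    needs it of the graph before the step.\<close>
  from assms(3,1,2) have "multigraph Gm \<and> splits Gm"
  proof (induction rule: minor_of.induct)
    case (refl G)
    then show ?case by simp
  next
    case (delete H G e)
    then have H: "multigraph H" "splits H" by simp_all
    have "splits (delete_edge H e)"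
    proof (rule splits_mono[OF H(2)])
      fix I J K assume "I \<subseteq> edges (delete_edge H e)" "J \<subseteq> edges (delete_edge H e)"
        "K \<subseteq> edges (delete_edge H e)" "card I = card J" "dodgson_poly H I J K = 0"
      then show "dodgson_poly (delete_edge H e) I J K = 0"
        using delete.hyps(2)
        by (intro dodgson_poly_delete_edge_eq_0[OF H(1)]) (auto simp: delete_edge_def)
    qed (auto simp: delete_edge_def)
    then show ?case using multigraph_delete_edge[OF H(1)] by simp
  next
    case (contract H G e H')
    then have H: "multigraph H" "splits H" by simp_all
    have edges: "edges H' = edges H - {e}"
      using contract.hyps(2) by (simp add: contracts_to_def)
    have "splits H'"
    proof (rule splits_mono[OF H(2)])
      fix I J K assume "I \<subseteq> edges H'" "J \<subseteq> edges H'" "K \<subseteq> edges H'" "card I = card J"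
        "dodgson_poly H I J K = 0"
      then show "dodgson_poly H' I J K = 0"
        using edges by (intro dodgson_poly_contract_eq_0[OF H(1) contract.hyps(2)]) auto
    qed (auto simp: edges)
    then show ?case using multigraph_contracts_to[OF H(1) contract.hyps(2)] by simp
  qed
  then show ?thesis ..
qed

end
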